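(* Let $1\le m\le n$ be integers and $p\in[0,1]$. Let $Q_{m,n,p}$ be the conditional distribution of $a_m$ given $\alpha\in\mathrm{PF}_{m,n}$ under the probabilistic parking protocol with parameter $p$, and let $\mathrm{Uni}_n$ be the uniform distribution on $[n]$. Then $$\|Q_{m,n,p}-\mathrm{Uni}_n\|_{\mathrm{TV}}\le\frac{m-1}{(n+1)(n-m+1)}$$ and $$\|Q_{m,n,p}-\mathrm{Uni}_n\|_{\mathrm{TV}}\ge\frac{|2p-1|}{4n}\left|1-\frac{e^{n+1}(m-1)!\,\mathbb{P}(Z\le m-1)}{(n+1)^{m-1}}\right|,$$ where $Z$ is a Poisson random variable with parameter $\lambda=n+1$. Additionally, for $p=1/2$, $$\|Q_{m,n,1/2}-\mathrm{Uni}_n\|_{\mathrm{TV}}\ge\frac12\left|\frac{n^{m-2}}{2(n+1)^{m-1}}-\frac{1}{2(n+1)}\left[1+\frac{n-2m+2}{n(n-m+1)}\right]\right|.$$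
   Context: $[n]=\{1,\ldots,n\}$. Probabilistic parking protocol with parameter $p\in[0,1]$: there are $m$ cars and a one-way street with $n\ge m$ spots numbered $1,\ldots,n$. Cars $1,\ldots,m$ arrive in order; car $i$ has preference $a_i\in[n]$ and first goes to spot $a_i$. If spot $a_i$ is unoccupied, the car parks there. If it is occupied, the driver tosses (once) a biased coin, independent of everything else: with probability $p$ the car moves forward and parks in the first unoccupied spot with number greater than $a_i$, if one exists; with probability $1-p$ the car moves backward and parks in the first unoccupied spot encountered (the largest unoccupied number less than $a_i$), if one exists. If there is no unoccupied spot in the chosen direction, the car fails to park. The preference list $\alpha=(a_1,\ldots,a_m)$ is chosen uniformly at random from $[n]^m$. "$\alpha\in\mathrm{PF}_{m,n}$" denotes the event that all $m$ cars with preference list $\alpha$ succeed in parking; probabilities are over both the uniform choice of $\alpha$ and the coin tosses. $Q_{m,n,p}(j)=\mathbb{P}(a_m=j\mid\alpha\in\mathrm{PF}_{m,n})$ for $j\in[n]$. The total variation distance of probability distributions $P,Q$ on $[n]$ is $\|P-Q\|_{\mathrm{TV}}=\frac12\sum_{j=1}^n|P(j)-Q(j)|$. *)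

theory Defs
  imports "HOL-Probability.Probability" "HOL-Library.Monad_Syntax"
begin

text \<open>
  A street has spots \<open>1, \<dots>, n\<close>. Below, \<open>U\<close> is the set of occupied spots and \<open>a\<close> the preference of
  the arriving car. The value \<open>None\<close> means that the car fails to park.
\<close>

definition forward_spot :: "nat \<Rightarrow> nat set \<Rightarrow> nat \<Rightarrow> nat option" where
  "forward_spot n U a =
     (let F = {s \<in> {1..n}. a < s \<and> s \<notin> U} in if F = {} then None else Some (Min F))"

definition backward_spot :: "nat \<Rightarrow> nat set \<Rightarrow> nat \<Rightarrow> nat option" where
  "backward_spot n U a =
     (let B = {s \<in> {1..n}. s < a \<and> s \<notin> U} in if B = {} then None else Some (Max B))"

definition park_car :: "nat \<Rightarrow> real \<Rightarrow> nat set \<Rightarrow> nat \<Rightarrow> nat option pmf" where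
  "park_car n p U a =
     (if a \<notin> U then return_pmf (Some a)
      else do {
        forward \<leftarrow> bernoulli_pmf p;
        return_pmf (if forward then forward_spot n U a else backward_spot n U a)
      })"

text \<open>
  The list of outcomes of the cars with the given preferences, in order of arrival, when the
  spots in \<open>U\<close> are already occupied. A car that fails to park leaves the street unchanged.
\<close>

primrec park_cars :: "nat \<Rightarrow> real \<Rightarrow> nat set \<Rightarrow> nat list \<Rightarrow> nat option list pmf" where
  "park_cars n p U [] = return_pmf []"
| "park_cars n p U (a # as) = do {
     r \<leftarrow> park_car n p U a;
     rs \<leftarrow> park_cars n p (U \<union> set_option r) as;
     return_pmf (r # rs)
   }"

definition pref_lists :: "nat \<Rightarrow> nat \<Rightarrow> nat list set" where
  "pref_lists m n = {\<alpha>. length \<alpha> = m \<and> set \<alpha> \<subseteq> {1..n}}"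

text \<open>Joint law of the preference list and the outcomes of the cars.\<close>

definition parking_pmf :: "nat \<Rightarrow> nat \<Rightarrow> real \<Rightarrow> (nat list \<times> nat option list) pmf" where
  "parking_pmf m n p = do {
     \<alpha> \<leftarrow> pmf_of_set (pref_lists m n);
     rs \<leftarrow> park_cars n p {} \<alpha>;
     return_pmf (\<alpha>, rs)
   }"

definition all_parked :: "nat list \<times> nat option list \<Rightarrow> bool" where
  "all_parked \<omega> \<longleftrightarrow> None \<notin> set (snd \<omega>)"

text \<open>Lists are indexed from \<open>0\<close>, so the preference \<open>a\<^sub>m\<close> of the last car is at index \<open>m - 1\<close>.\<close>

definition Q :: "nat \<Rightarrow> nat \<Rightarrow> real \<Rightarrow> nat \<Rightarrow> real" where
  "Q m n p j = \<P>(\<omega> in measure_pmf (parking_pmf m n p). fst \<omega> ! (m - 1) = j \<bar> all_parked \<omega>)"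

definition Uni :: "nat \<Rightarrow> nat \<Rightarrow> real" where
  "Uni n = pmf (pmf_of_set {1..n})"

definition tv_dist :: "nat \<Rightarrow> (nat \<Rightarrow> real) \<Rightarrow> (nat \<Rightarrow> real) \<Rightarrow> real" where
  "tv_dist n P R = 1/2 * (\<Sum>j=1..n. \<bar>P j - R j\<bar>)"

end

theory Submission
  imports Defs
begin

text \<open>
  Instead of probabilities, the proof works with totals over all preferences. The operator
  \<open>add_car l r p\<close> sends a functional \<open>g\<close> of the set of occupied spots to the functional whose value at
  \<open>U\<close> is the sum, over the preferences of one more car on the street \<open>{l<..<r}\<close>, of the expected value of
  \<open>g\<close> after this car has parked, where a failure counts \<open>0\<close>. Its \<open>k\<close>-th power describes \<open>k\<close> cars.

  A spot \<open>e\<close> that is still empty at the end separates the cars on its left from those on its right. On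
  functionals that vanish unless \<open>e\<close> is empty, and otherwise are products over the two sides, the operator
  obeys a Leibniz rule (\<open>add_car_split_at\<close>), and its powers follow a binomial formula. Cutting at the
  empty spot nearest to an end of the street gives the weight \<open>block_weight\<close> of the outcomes with a
  full block of exactly \<open>s\<close> spots at that end. It is the same for both ends and for all \<open>p\<close>.

  The last car, with preference \<open>j\<close>, fails only when it drives forward and all spots from \<open>j\<close> on are
  taken, or drives backward and all spots up to \<open>j\<close> are. This gives a recursion for the total weight of
  \<open>k\<close> cars that park, which Abel's identity solves by \<open>(n - k + 1) (n + 1)\<^bsup>k-1\<^esup>\<close> (\<open>add_car_pow_one\<close>). It
  also gives the conditional law of the last preference (\<open>Q_eq\<close>): up to normalisation, its deviation
  from uniform at \<open>j\<close> is the mean of \<open>p t(n + 1 - j) + (1 - p) t(j)\<close> over all spots minus its value at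
  \<open>j\<close>, where \<open>t(i) \<ge> 0\<close> is the weight of an end block of length at least \<open>i\<close>.

  The three bounds are read off from this formula. The deviation from the mean of a nonnegative vector has
  \<open>\<ell>\<^sup>1\<close> norm at most twice the total, and the total is \<open>(m - 1) (n + 1)\<^bsup>m-2\<^esup>\<close>. Testing with the linear
  function \<open>j - (n + 1) / 2\<close>, which is odd under reflection, produces the factor \<open>2 p - 1\<close> and the sum of
  \<open>s (n - s)\<close> over the end block lengths \<open>s\<close>; an identity of Abel type turns the latter into a
  truncated exponential series, that is, a Poisson probability. For \<open>p = 1/2\<close>, where this test yields
  nothing, the term \<open>j = 1\<close> of the distance is computed exactly.
\<close>

section \<open>Abel's binomial identities\<close>

lemma binomial_sum_Suc:
  fixes f :: "nat \<Rightarrow> real"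
  shows "(\<Sum>k\<le>Suc M. real (Suc M choose k) * f k) =
         (\<Sum>k\<le>M. real (M choose k) * (f k + f (Suc k)))"
proof -
  have "(\<Sum>k\<le>Suc M. real (Suc M choose k) * f k) =
      f 0 + (\<Sum>k\<le>M. real (M choose k) * f (Suc k)) + (\<Sum>k\<le>M. real (M choose Suc k) * f (Suc k))"
    by (subst sum.atMost_Suc_shift) (simp add: algebra_simps sum.distrib del: sum.atMost_Suc)
  also have "f 0 + (\<Sum>k\<le>M. real (M choose Suc k) * f (Suc k)) = (\<Sum>k\<le>Suc M. real (M choose k) * f k)"
    by (subst sum.atMost_Suc_shift) simp
  then have "f 0 + (\<Sum>k\<le>M. real (M choose k) * f (Suc k)) + (\<Sum>k\<le>M. real (M choose Suc k) * f (Suc k))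
     = (\<Sum>k\<le>M. real (M choose k) * f (Suc k)) + (\<Sum>k\<le>M. real (M choose k) * f k)"
    by simp
  finally show ?thesis by (simp add: algebra_simps sum.distrib)
qed

lemma binomial_sum_absorb:
  fixes f :: "nat \<Rightarrow> real"
  shows "(\<Sum>k\<le>Suc M. real (Suc M choose k) * (real k * f k)) =
         real (Suc M) * (\<Sum>k\<le>M. real (M choose k) * f (Suc k))"
proof -
  have "real (Suc M choose Suc k) * (real (Suc k) * f (Suc k)) =
        real (Suc M) * (real (M choose k) * f (Suc k))" for k
  proof -
    have "real (Suc M choose Suc k) * real (Suc k) = real (Suc M) * real (M choose k)"
      by (metis Suc_times_binomial mult.commute of_nat_mult)
    then show ?thesis by (metis mult.assoc)
  qed
  then have "(\<Sum>k\<le>M. real (Suc M choose Suc k) * (real (Suc k) * f (Suc k))) =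
      real (Suc M) * (\<Sum>k\<le>M. real (M choose k) * f (Suc k))"
    by (simp only: sum_distrib_left)
  then show ?thesis
    by (subst sum.atMost_Suc_shift) (simp del: sum.atMost_Suc of_nat_Suc binomial_Suc_Suc)
qed

text \<open>
  An \<open>M\<close>-th finite difference annihilates polynomials of degree below \<open>M\<close>. By Pascal's rule one
  difference operator is split off; it lowers the degree, so the induction hypothesis applies to
  every power that remains.
\<close>

lemma alternating_binomial_power_sum_eq_0:
  fixes x :: real
  assumes "j < M"
  shows "(\<Sum>k\<le>M. real (M choose k) * ((-1) ^ k * (x + real k) ^ j)) = 0"
  using assms
proof (induction M arbitrary: j)
  case 0
  then show ?case by simp
next
  case (Suc M)
  have diff: "(-1) ^ k * (x + real k) ^ j + (-1) ^ Suc k * (x + real (Suc k)) ^ j =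
      - (\<Sum>i<j. real (j choose i) * ((-1) ^ k * (x + real k) ^ i))" for k
  proof -
    have "(x + real (Suc k)) ^ j = ((x + real k) + 1) ^ j"
      by (simp add: add_ac)
    also have "\<dots> = (\<Sum>i\<le>j. real (j choose i) * (x + real k) ^ i)"
      by (subst binomial_ring) simp
    also have "\<dots> = (\<Sum>i<j. real (j choose i) * (x + real k) ^ i) + (x + real k) ^ j"
      by (simp flip: lessThan_Suc_atMost)
    finally show ?thesis
      by (simp add: sum_distrib_left sum_negf algebra_simps)
  qed
  have "(\<Sum>k\<le>Suc M. real (Suc M choose k) * ((-1) ^ k * (x + real k) ^ j)) =
      - (\<Sum>k\<le>M. \<Sum>i<j. real (j choose i) * (real (M choose k) * ((-1) ^ k * (x + real k) ^ i)))"
    by (subst binomial_sum_Suc, subst diff)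
       (simp add: sum_distrib_left sum_negf algebra_simps)
  also have "\<dots> = - (\<Sum>i<j. real (j choose i) * (\<Sum>k\<le>M. real (M choose k) * ((-1) ^ k * (x + real k) ^ i)))"
    by (subst sum.swap) (simp add: sum_distrib_left)
  also have "\<dots> = 0"
    using Suc by (auto intro!: sum.neutral)
  finally show ?case .
qed

text \<open>
  As functions of \<open>z\<close>, the two sides have the same derivative by the identity for \<open>M - 1\<close>, so their
  difference is constant. At \<open>z = - x\<close> the left-hand side becomes \<open>x\<close> times an \<open>M\<close>-th finite difference
  of \<open>t ^ (M - 1)\<close>, hence \<open>0\<close>. The factor \<open>x (x + k)\<^bsup>k-1\<^esup>\<close> is written with a quotient because its
  exponent is negative for \<open>k = 0\<close>.
\<close>

theorem abel_identity:
  fixes x z :: real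
  assumes "x > 0"
  shows "(\<Sum>k\<le>M. real (M choose k) * (x * (x + real k) ^ k / (x + real k) * (z - real k) ^ (M - k))) =
         (x + z) ^ M"
proof (induction M arbitrary: z)
  case 0
  then show ?case using assms by simp
next
  case (Suc M)
  define c where "c k = x * (x + real k) ^ k / (x + real k)" for k
  define D where "D z = (\<Sum>k\<le>Suc M. real (Suc M choose k) * (c k * (z - real k) ^ (Suc M - k))) - (x + z) ^ Suc M" for z
  have deriv: "(D has_real_derivative 0) (at z)" for z
  proof -
    have sum_eq: "(\<Sum>k\<le>Suc M. real (Suc M choose k) * (c k * (real (Suc M - k) * (z - real k) ^ (Suc M - k - 1)))) =
       real (Suc M) * (x + z) ^ M"
    proof -
      have step: "real (Suc M choose k) * (c k * (real (Suc M - k) * (z - real k) ^ (Suc M - k - 1))) =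
         real (Suc M) * (real (M choose k) * (c k * (z - real k) ^ (M - k)))" if "k \<le> M" for k
      proof -
        have "(Suc M - k) * (Suc M choose k) = Suc M * (M choose k)"
          using binomial_absorb_comp[of "Suc M" k] by simp
        then have absorb: "real (Suc M - k) * real (Suc M choose k) = real (Suc M) * real (M choose k)"
          by (metis of_nat_mult)
        have comm: "b * (c' * (a * w)) = d * (e * (c' * w))" if "a * b = d * e" for a b c' d e w :: real
        proof -
          have "b * (c' * (a * w)) = (a * b) * (c' * w)" by (simp only: mult_ac)
          also have "\<dots> = d * (e * (c' * w))" unfolding that by (simp only: mult_ac)
          finally show ?thesis .
        qed
        have "Suc M - k - 1 = M - k" by simp
        then show ?thesis by (simp only: comm[OF absorb])
      qed
      have "(\<Sum>k\<le>Suc M. real (Suc M choose k) * (c k * (real (Suc M - k) * (z - real k) ^ (Suc M - k - 1)))) =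
        (\<Sum>k\<le>M. real (Suc M choose k) * (c k * (real (Suc M - k) * (z - real k) ^ (Suc M - k - 1))))"
        unfolding sum.atMost_Suc by (simp only: diff_self_eq_0 of_nat_0 mult_zero_left mult_zero_right add_0_right)
      also have "\<dots> = real (Suc M) * (\<Sum>k\<le>M. real (M choose k) * (c k * (z - real k) ^ (M - k)))"
        unfolding sum_distrib_left by (intro sum.cong refl step) simp
      finally show ?thesis using Suc.IH[of z] by (simp add: c_def)
    qed
    have "((\<lambda>z. b * (c' * (z - a) ^ j)) has_real_derivative b * (c' * (real j * (z - a) ^ (j - 1)))) (at z)"
      for a b c' :: real and j
      by (auto intro!: derivative_eq_intros)
    moreover have "((\<lambda>z. (x + z) ^ Suc M) has_real_derivative real (Suc M) * (x + z) ^ M) (at z)"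
      by (auto intro!: derivative_eq_intros simp del: power_Suc)
    ultimately have "(D has_real_derivative (\<Sum>k\<le>Suc M. real (Suc M choose k) * (c k * (real (Suc M - k) * (z - real k) ^ (Suc M - k - 1)))) - real (Suc M) * (x + z) ^ M) (at z)"
      unfolding D_def by (intro DERIV_diff DERIV_sum)
    then show ?thesis unfolding sum_eq by simp
  qed
  have at0: "D (- x) = 0"
  proof -
    have "real (Suc M choose k) * (c k * (- x - real k) ^ (Suc M - k)) =
       x * (-1) ^ Suc M * (real (Suc M choose k) * ((-1) ^ k * (x + real k) ^ M))" if le: "k \<le> Suc M" for k
    proof -
      obtain j where j: "Suc M = k + j" using le_Suc_ex[OF le] by blast
      define y where "y = x + real k"
      have y: "y \<noteq> 0" "- x - real k = (-1) * y" using assms by (simp_all add: y_def)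
      have "y ^ k * y ^ j = y ^ M * y"
        by (simp only: power_add[symmetric] j[symmetric] power_Suc2)
      moreover have "(-1::real) ^ j = (-1) ^ (k + j) * (-1) ^ k"
        by (simp add: power_add)
      ultimately show ?thesis
        unfolding c_def j y(2) y_def[symmetric] power_mult_distrib
        using y(1) by (simp add: field_simps)
    qed
    then have "(\<Sum>k\<le>Suc M. real (Suc M choose k) * (c k * (- x - real k) ^ (Suc M - k))) =
      x * (-1) ^ Suc M * (\<Sum>k\<le>Suc M. real (Suc M choose k) * ((-1) ^ k * (x + real k) ^ M))"
      unfolding sum_distrib_left by (intro sum.cong) auto
    then show ?thesis
      unfolding D_def using alternating_binomial_power_sum_eq_0[of M "Suc M" x] by simp
  qed
  have "D z = D (- x)"
    using deriv DERIV_isconst_all by blast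
  then show ?case
    using at0 by (simp add: D_def c_def)
qed

text \<open>
  The polynomial \<open>w\<^bsup>L\<^esup> + L w\<^bsup>L-1\<^esup> + L (L - 1) w\<^bsup>L-2\<^esup> + \<dots>\<close>, which is \<open>exp w\<close> times the upper
  incomplete Gamma function \<open>\<Gamma>(L + 1, w)\<close>; this is how the Poisson distribution function
  enters.
\<close>

definition exp_trunc :: "nat \<Rightarrow> real \<Rightarrow> real" where
  "exp_trunc L w = fact L * (\<Sum>k\<le>L. w ^ k / fact k)"

lemma exp_trunc_Suc: "exp_trunc (Suc L) w = w ^ Suc L + real (Suc L) * exp_trunc L w"
proof -
  have "fact (Suc L) * (w ^ Suc L / fact (Suc L)) = w ^ Suc L"
    by (simp del: fact_Suc)
  then have "exp_trunc (Suc L) w = fact (Suc L) * (\<Sum>k\<le>L. w ^ k / fact k) + w ^ Suc L"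
    by (simp add: exp_trunc_def distrib_left del: fact_Suc power_Suc)
  then show ?thesis
    by (simp add: exp_trunc_def del: power_Suc)
qed

text \<open>
  Splitting one factor \<open>x + k\<close> off \<open>(x + k)\<^bsup>k\<^esup>\<close> gives an Abel sum from the summand \<open>x\<close>; the summand
  \<open>k\<close> is absorbed by the binomial coefficient and leaves a sum of the same shape for \<open>L - 1\<close> with
  \<open>x + 1\<close> and \<open>z - 1\<close>. As \<open>x + z\<close> is unchanged, this is the recursion of \<^const>\<open>exp_trunc\<close>.
\<close>

lemma abel_sum_eq_exp_trunc:
  fixes x z :: real
  assumes "x > 0"
  shows "(\<Sum>k\<le>L. real (L choose k) * ((x + real k) ^ k * (z - real k) ^ (L - k))) = exp_trunc L (x + z)"
  using assms
proof (induction L arbitrary: x z)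
  case 0
  then show ?case by (simp add: exp_trunc_def)
next
  case (Suc L)
  let ?q = "\<lambda>k. (x + real k) ^ k / (x + real k) * (z - real k) ^ (Suc L - k)"
  have "(x + real k) ^ k * (z - real k) ^ (Suc L - k) =
      x * (x + real k) ^ k / (x + real k) * (z - real k) ^ (Suc L - k) + real k * ?q k" for k
  proof -
    have "x + real k \<noteq> 0" using Suc.prems by linarith
    then have "(x + real k) ^ k = (x + real k) * ((x + real k) ^ k / (x + real k))" by simp
    then show ?thesis by (metis (no_types, opaque_lifting) distrib_right mult.assoc times_divide_eq_right)
  qed
  then have "(\<Sum>k\<le>Suc L. real (Suc L choose k) * ((x + real k) ^ k * (z - real k) ^ (Suc L - k))) =
     (x + z) ^ Suc L + (\<Sum>k\<le>Suc L. real (Suc L choose k) * (real k * ?q k))"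
    unfolding abel_identity[OF Suc.prems, of "Suc L" z, symmetric]
    by (simp only: sum.distrib distrib_left)
  also have "(\<Sum>k\<le>Suc L. real (Suc L choose k) * (real k * ?q k)) =
     real (Suc L) * (\<Sum>k\<le>L. real (L choose k) * ((x + 1 + real k) ^ k * (z - 1 - real k) ^ (L - k)))"
  proof -
    have "?q (Suc k) = (x + 1 + real k) ^ k * (z - 1 - real k) ^ (L - k)" for k
    proof -
      have "x + real (Suc k) = x + 1 + real k" "z - real (Suc k) = z - 1 - real k" by simp_all
      moreover have "x + 1 + real k \<noteq> 0" using Suc.prems by linarith
      ultimately show ?thesis by (simp add: add_ac diff_diff_eq)
    qed
    then show ?thesis by (simp only: binomial_sum_absorb)
  qed
  also have "(\<Sum>k\<le>L. real (L choose k) * ((x + 1 + real k) ^ k * (z - 1 - real k) ^ (L - k))) = exp_trunc L (x + z)"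
    using Suc.IH[of "x + 1" "z - 1"] Suc.prems by simp
  finally show ?case by (simp only: exp_trunc_Suc)
qed

section \<open>Weights of end blocks\<close>

text \<open>
  The value \<open>(n - k + 1) (n + 1)\<^bsup>k-1\<^esup>\<close> of the expected number of preference lists for which \<open>k\<close> cars all
  park on \<open>n\<close> spots. The quotient makes it \<open>1\<close> for \<open>k = 0\<close>.
\<close>

definition park_weight :: "nat \<Rightarrow> nat \<Rightarrow> real" where
  "park_weight k n = (real n + 1 - real k) * (real n + 1) ^ k / (real n + 1)"

text \<open>
  The weight of the outcomes in which \<open>k\<close> cars park on \<open>n\<close> spots and the full block at one given end
  of the street has length exactly \<open>s\<close>: choose the cars of that block, let them fill
  \<open>s\<close> spots, and let the others park beyond the empty spot that delimits the block.
\<close>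

definition block_weight :: "nat \<Rightarrow> nat \<Rightarrow> nat \<Rightarrow> real" where
  "block_weight k n s = real (k choose s) * park_weight s s * park_weight (k - s) (n - Suc s)"

lemma block_weight_eq:
  assumes "k < n" "s \<le> k"
  shows "block_weight k n s = real (k choose s) * ((real s + 1) ^ s / (real s + 1) * ((real n - real k) * (real n - real s) ^ (k - s) / (real n - real s)))"
  using assms by (simp add: block_weight_def park_weight_def of_nat_diff)

lemma block_weight_nonneg: "k < n \<Longrightarrow> 0 \<le> block_weight k n s"
proof (cases "s \<le> k")
  case True
  assume "k < n"
  then show ?thesis using True by (subst block_weight_eq) auto
qed (simp add: block_weight_def binomial_eq_0)

text \<open>
  Once the factor \<open>s\<close> is absorbed by the binomial coefficient, only the weight of the remaining street
  has a negative exponent left; read in the opposite order, the sum is Abel's.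
\<close>

lemma sum_block_weight_length:
  assumes "k < n"
  shows "(\<Sum>s<n. real s * block_weight k n s) = real k * (real n + 1) ^ k / (real n + 1)"
proof -
  have "(\<Sum>s<n. real s * block_weight k n s) = (\<Sum>s\<le>k. real s * block_weight k n s)"
    using assms by (intro sum.mono_neutral_right) (auto simp: block_weight_def)
  also have "\<dots> = real k * (real n + 1) ^ k / (real n + 1)"
  proof (cases k)
    case 0
    then show ?thesis by simp
  next
    case (Suc L)
    let ?f = "\<lambda>s. (real s + 1) ^ s / (real s + 1) * ((real n - real k) * (real n - real s) ^ (k - s) / (real n - real s))"
    let ?y = "real n - real k"
    have "(\<Sum>s\<le>k. real s * block_weight k n s) = (\<Sum>s\<le>Suc L. real (Suc L choose s) * (real s * ?f s))"
      unfolding Suc[symmetric] using assms by (intro sum.cong) (auto simp: block_weight_eq)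
    also have "\<dots> = real (Suc L) * (\<Sum>s\<le>L. real (L choose s) * ?f (Suc s))"
      by (rule binomial_sum_absorb)
    also have "(\<Sum>s\<le>L. real (L choose s) * ?f (Suc s)) =
       (\<Sum>i\<le>L. real (L choose i) * (?y * (?y + real i) ^ i / (?y + real i) * (real L + 2 - real i) ^ (L - i)))"
    proof (rule sum.reindex_bij_witness[of _ "\<lambda>i. L - i" "\<lambda>i. L - i"], goal_cases)
      case (5 s)
      then have "s \<le> L" by simp
      have e: "real (Suc s) + 1 = real L + 2 - real (L - s)" "real n - real (Suc s) = ?y + real (L - s)"
        "k - Suc s = L - s" "L - (L - s) = s" "L choose (L - s) = L choose s"
        using \<open>s \<le> L\<close> Suc by (simp_all add: of_nat_diff binomial_symmetric[symmetric])
      have "real L + 2 - real (L - s) \<noteq> 0" using \<open>s \<le> L\<close> by (simp add: of_nat_diff)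
      then show ?case unfolding e by simp
    qed auto
    also have "\<dots> = (?y + (real L + 2)) ^ L"
      using assms by (intro abel_identity) simp
    also have "?y + (real L + 2) = real n + 1" using Suc by simp
    finally show ?thesis using Suc by simp
  qed
  finally show ?thesis .
qed

text \<open>
  As for the linear sum, but the factor \<open>n - s\<close> also removes the negative exponent from the weight of the
  remaining street, and the sum without negative exponents is a truncated exponential.
\<close>

lemma sum_block_weight_quadratic:
  assumes "k < n"
  shows "(\<Sum>s<n. real s * (real n - real s) * block_weight k n s) =
         (real n - real k) * (exp_trunc k (real n + 1) - (real n + 1) ^ k)"
proof -
  have "(\<Sum>s<n. real s * (real n - real s) * block_weight k n s) = (\<Sum>s\<le>k. real s * (real n - real s) * block_weight k n s)"
    using assms by (intro sum.mono_neutral_right) (auto simp: block_weight_def)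
  also have "\<dots> = (real n - real k) * (exp_trunc k (real n + 1) - (real n + 1) ^ k)"
  proof (cases k)
    case 0
    then show ?thesis by (simp add: exp_trunc_def)
  next
    case (Suc L)
    let ?f = "\<lambda>s. (real s + 1) ^ s / (real s + 1) * (real n - real s) ^ (k - s)"
    have "(\<Sum>s\<le>k. real s * (real n - real s) * block_weight k n s) = (\<Sum>s\<le>Suc L. (real n - real k) * (real (Suc L choose s) * (real s * ?f s)))"
      unfolding Suc[symmetric] using assms by (intro sum.cong) (auto simp: block_weight_eq)
    also have "\<dots> = (real n - real k) * (real (Suc L) * (\<Sum>s\<le>L. real (L choose s) * ?f (Suc s)))"
      unfolding sum_distrib_left[symmetric] by (simp only: binomial_sum_absorb)
    also have "(\<Sum>s\<le>L. real (L choose s) * ?f (Suc s)) =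
       (\<Sum>s\<le>L. real (L choose s) * ((2 + real s) ^ s * ((real n - 1) - real s) ^ (L - s)))"
      using Suc by (intro sum.cong refl) (simp add: add_ac diff_diff_eq)
    also have "\<dots> = exp_trunc L (real n + 1)"
      by (subst abel_sum_eq_exp_trunc) (auto simp: add_ac)
    also have "real (Suc L) * exp_trunc L (real n + 1) = exp_trunc k (real n + 1) - (real n + 1) ^ k"
      unfolding Suc exp_trunc_Suc by simp
    finally show ?thesis .
  qed
  finally show ?thesis .
qed

section \<open>Street intervals and the operator of one more car\<close>

text \<open>
  The occupied set \<open>U\<close> is updated by a car with preference \<open>a\<close> on the street \<open>{l<..<r}\<close>, and the functional
  \<open>g\<close> of the occupied set is averaged over the coin; a failing car contributes \<open>0\<close>. The spots \<open>l\<close> and \<open>r\<close> act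
  as walls, so that an empty spot can serve as a wall of a shorter street.
\<close>

definition try_pref :: "nat \<Rightarrow> nat \<Rightarrow> real \<Rightarrow> nat \<Rightarrow> (nat set \<Rightarrow> real) \<Rightarrow> nat set \<Rightarrow> real" where
  "try_pref l r p a g U =
     (if a \<notin> U then g (insert a U)
      else p * (let F = {s \<in> {l<..<r}. a < s \<and> s \<notin> U} in if F = {} then 0 else g (insert (Min F) U))
         + (1 - p) * (let B = {s \<in> {l<..<r}. s < a \<and> s \<notin> U} in if B = {} then 0 else g (insert (Max B) U)))"

definition add_car :: "nat \<Rightarrow> nat \<Rightarrow> real \<Rightarrow> (nat set \<Rightarrow> real) \<Rightarrow> nat set \<Rightarrow> real" where
  "add_car l r p g U = (\<Sum>a\<in>{l<..<r}. try_pref l r p a g U)"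

lemma add_car_add: "add_car l r p (\<lambda>X. g X + h X) = (\<lambda>U. add_car l r p g U + add_car l r p h U)"
  unfolding add_car_def sum.distrib[symmetric]
  by (intro ext sum.cong) (auto simp: try_pref_def Let_def algebra_simps)

lemma add_car_scale: "add_car l r p (\<lambda>X. c * g X) = (\<lambda>U. c * add_car l r p g U)"
  unfolding add_car_def sum_distrib_left
  by (intro ext sum.cong) (auto simp: try_pref_def Let_def algebra_simps)

lemma add_car_pow_add:
  "(add_car l r p ^^ k) (\<lambda>X. g X + h X) = (\<lambda>U. (add_car l r p ^^ k) g U + (add_car l r p ^^ k) h U)"
  by (induction k) (simp_all add: add_car_add)

lemma add_car_pow_scale:
  "(add_car l r p ^^ k) (\<lambda>X. c * g X) = (\<lambda>U. c * (add_car l r p ^^ k) g U)"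
  by (induction k) (simp_all add: add_car_scale)

lemma add_car_pow_sum:
  assumes "finite I"
  shows "(add_car l r p ^^ k) (\<lambda>X. \<Sum>i\<in>I. g i X) = (\<lambda>U. \<Sum>i\<in>I. (add_car l r p ^^ k) (g i) U)"
  using assms
proof (induction I)
  case empty
  then show ?case using add_car_pow_scale[of k l r p 0 "\<lambda>_. 0"] by simp
next
  case (insert i I)
  then show ?case by (simp add: add_car_pow_add)
qed

lemma add_car_cong:
  assumes "\<And>s. s \<in> {l<..<r} \<Longrightarrow> s \<notin> U \<Longrightarrow> g (insert s U) = h (insert s U)"
  shows "add_car l r p g U = add_car l r p h U"
  unfolding add_car_def
proof (rule sum.cong)
  fix a assume a: "a \<in> {l<..<r}"
  let ?F = "{s \<in> {l<..<r}. a < s \<and> s \<notin> U}" and ?B = "{s \<in> {l<..<r}. s < a \<and> s \<notin> U}"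
  have fin: "finite ?F" "finite ?B" by auto
  have "?F \<noteq> {} \<Longrightarrow> Min ?F \<in> ?F" "?B \<noteq> {} \<Longrightarrow> Max ?B \<in> ?B"
    using Min_in[OF fin(1)] Max_in[OF fin(2)] by blast+
  then have "?F \<noteq> {} \<Longrightarrow> g (insert (Min ?F) U) = h (insert (Min ?F) U)"
    "?B \<noteq> {} \<Longrightarrow> g (insert (Max ?B) U) = h (insert (Max ?B) U)"
    using assms by blast+
  then show "try_pref l r p a g U = try_pref l r p a h U"
    unfolding try_pref_def Let_def using assms[OF a] by auto
qed simp

text \<open>
  Only occupied sets with the right number of spots can be reached, so functionals may be compared on
  those alone.
\<close>

lemma add_car_pow_cong:
  assumes "finite U" and "\<And>X. \<lbrakk>finite X; X \<subseteq> U \<union> {l<..<r}; card X = card U + k\<rbrakk> \<Longrightarrow> g X = h X"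
  shows "(add_car l r p ^^ k) g U = (add_car l r p ^^ k) h U"
  using assms
proof (induction k arbitrary: U)
  case 0
  then show ?case by auto
next
  case (Suc k)
  have "(add_car l r p ^^ k) g (insert s U) = (add_car l r p ^^ k) h (insert s U)"
    if "s \<in> {l<..<r}" "s \<notin> U" for s
  proof (rule Suc.IH)
    show "finite (insert s U)" using Suc.prems(1) by simp
    fix X assume "finite X" "X \<subseteq> insert s U \<union> {l<..<r}" "card X = card (insert s U) + k"
    then show "g X = h X" using that Suc.prems(1) by (intro Suc.prems(2)) auto
  qed
  then show ?case
    by (auto intro: add_car_cong)
qed

text \<open>
  That \<open>e\<close> stays empty is made part of the functional: an occupied spot never becomes empty again, so
  the value \<open>0\<close> discards every outcome in which \<open>e\<close> is taken at some time.
\<close>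

definition split_at :: "nat \<Rightarrow> (nat set \<Rightarrow> real) \<Rightarrow> (nat set \<Rightarrow> real) \<Rightarrow> nat set \<Rightarrow> real" where
  "split_at e f g U = (if e \<in> U then 0 else f (U \<inter> {..<e}) * g (U \<inter> {e<..}))"

text \<open>
  With \<open>e\<close> empty, a car that starts left of \<open>e\<close> never sees a spot beyond \<open>e\<close>. It behaves as on the street
  with the right wall at \<open>e\<close>, except that instead of failing forward it parks at \<open>e\<close>, which
  \<^const>\<open>split_at\<close> also evaluates to \<open>0\<close>.
\<close>

lemma try_pref_split_at_left:
  assumes "l < e" "e < r" "l < a" "a < e" "e \<notin> U"
  shows "try_pref l r p a (split_at e f g) U = try_pref l e p a f (U \<inter> {..<e}) * g (U \<inter> {e<..})"
proof -
  have ins: "split_at e f g (insert s U) = f (insert s (U \<inter> {..<e})) * g (U \<inter> {e<..})" if "s < e" for s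
  proof -
    have "insert s U \<inter> {..<e} = insert s (U \<inter> {..<e})" "insert s U \<inter> {e<..} = U \<inter> {e<..}"
      using that by auto
    then show ?thesis using that assms by (simp add: split_at_def)
  qed
  let ?F = "{s \<in> {l<..<r}. a < s \<and> s \<notin> U}" and ?F' = "{s \<in> {l<..<e}. a < s \<and> s \<notin> U \<inter> {..<e}}"
  let ?B = "{s \<in> {l<..<r}. s < a \<and> s \<notin> U}" and ?B' = "{s \<in> {l<..<e}. s < a \<and> s \<notin> U \<inter> {..<e}}"
  have B: "?B = ?B'" using assms by auto
  have eF: "e \<in> ?F" using assms by auto
  have F: "split_at e f g (insert (Min ?F) U) =
      (if ?F' = {} then 0 else f (insert (Min ?F') (U \<inter> {..<e}))) * g (U \<inter> {e<..})"
  proof (cases "?F' = {}")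
    case True
    then have "e \<le> s" if "s \<in> ?F" for s using that assms by force
    then have "Min ?F = e" using eF by (intro Min_eqI) auto
    then show ?thesis using True by (simp add: split_at_def)
  next
    case False
    then have m: "Min ?F' \<in> ?F'" by (intro Min_in) auto
    have "Min ?F = Min ?F'"
    proof (rule Min_eqI)
      fix y assume y: "y \<in> ?F"
      show "Min ?F' \<le> y"
      proof (cases "y < e")
        case True
        then show ?thesis using y by (intro Min_le) auto
      next
        case False
        then show ?thesis using m by auto
      qed
    qed (use m assms in auto)
    then show ?thesis using False m ins[of "Min ?F'"] by auto
  qed
  have Bv: "?B' \<noteq> {} \<Longrightarrow> Max ?B' < e"
    using Max_in[of ?B'] by auto
  have "?F \<noteq> {}" using eF by blast
  moreover have "a \<in> U \<inter> {..<e} \<longleftrightarrow> a \<in> U" using assms by simp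
  ultimately show ?thesis
    unfolding try_pref_def Let_def F B using assms Bv
    by (auto simp: ins algebra_simps)
qed

lemma try_pref_split_at_right:
  assumes "l < e" "e < r" "e < a" "a < r" "e \<notin> U"
  shows "try_pref l r p a (split_at e f g) U = f (U \<inter> {..<e}) * try_pref e r p a g (U \<inter> {e<..})"
proof -
  have ins: "split_at e f g (insert s U) = f (U \<inter> {..<e}) * g (insert s (U \<inter> {e<..}))" if "e < s" for s
  proof -
    have "insert s U \<inter> {e<..} = insert s (U \<inter> {e<..})" "insert s U \<inter> {..<e} = U \<inter> {..<e}"
      using that by auto
    then show ?thesis using that assms by (simp add: split_at_def)
  qed
  let ?F = "{s \<in> {l<..<r}. a < s \<and> s \<notin> U}" and ?F' = "{s \<in> {e<..<r}. a < s \<and> s \<notin> U \<inter> {e<..}}"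
  let ?B = "{s \<in> {l<..<r}. s < a \<and> s \<notin> U}" and ?B' = "{s \<in> {e<..<r}. s < a \<and> s \<notin> U \<inter> {e<..}}"
  have F: "?F = ?F'" using assms by auto
  have eB: "e \<in> ?B" using assms by auto
  have B: "split_at e f g (insert (Max ?B) U) =
      f (U \<inter> {..<e}) * (if ?B' = {} then 0 else g (insert (Max ?B') (U \<inter> {e<..})))"
  proof (cases "?B' = {}")
    case True
    then have "s \<le> e" if "s \<in> ?B" for s using that assms by force
    then have "Max ?B = e" using eB by (intro Max_eqI) auto
    then show ?thesis using True by (simp add: split_at_def)
  next
    case False
    then have m: "Max ?B' \<in> ?B'" by (intro Max_in) auto
    have "Max ?B = Max ?B'"
    proof (rule Max_eqI)
      fix y assume y: "y \<in> ?B"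
      show "y \<le> Max ?B'"
      proof (cases "e < y")
        case True
        then show ?thesis using y by (intro Max_ge) auto
      next
        case False
        then show ?thesis using m by auto
      qed
    qed (use m assms in auto)
    then show ?thesis using False m ins[of "Max ?B'"] by auto
  qed
  have Fv: "?F' \<noteq> {} \<Longrightarrow> e < Min ?F'"
    using Min_in[of ?F'] by auto
  have "?B \<noteq> {}" using eB by blast
  moreover have "a \<in> U \<inter> {e<..} \<longleftrightarrow> a \<in> U" using assms by simp
  ultimately show ?thesis
    unfolding try_pref_def Let_def F B using assms Fv
    by (auto simp: ins algebra_simps)
qed

text \<open>
  A Leibniz rule: the new car has its preference on one side of \<open>e\<close>, and the other factor is untouched.
  A preference for \<open>e\<close> itself fills \<open>e\<close> and is worth \<open>0\<close>.
\<close>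

lemma add_car_split_at:
  assumes "l < e" "e < r"
  shows "add_car l r p (split_at e f g) =
    (\<lambda>U. split_at e (add_car l e p f) g U + split_at e f (add_car e r p g) U)"
proof
  fix U
  show "add_car l r p (split_at e f g) U =
    split_at e (add_car l e p f) g U + split_at e f (add_car e r p g) U"
  proof (cases "e \<in> U")
    case True
    then have "try_pref l r p a (split_at e f g) U = 0" for a
      by (auto simp: try_pref_def Let_def split_at_def)
    then show ?thesis using True by (simp add: add_car_def split_at_def)
  next
    case False
    then have e: "try_pref l r p e (split_at e f g) U = 0"
      by (simp add: try_pref_def split_at_def)
    have "{l<..<r} = {l<..<e} \<union> ({e} \<union> {e<..<r})" using assms by auto
    then have "add_car l r p (split_at e f g) U =
       (\<Sum>a\<in>{l<..<e}. try_pref l r p a (split_at e f g) U) + (\<Sum>a\<in>{e<..<r}. try_pref l r p a (split_at e f g) U)"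
      unfolding add_car_def by (simp only:) (subst sum.union_disjoint, (auto simp: e)[4])
    then show ?thesis
      using False assms
      by (simp add: try_pref_split_at_left try_pref_split_at_right split_at_def add_car_def
                    sum_distrib_left sum_distrib_right)
  qed
qed

text \<open>
  The binomial coefficient counts which \<open>i\<close> of the \<open>k\<close> cars prefer a spot left of \<open>e\<close>.
\<close>

lemma add_car_pow_split_at:
  assumes "l < e" "e < r"
  shows "(add_car l r p ^^ k) (split_at e f g) =
    (\<lambda>U. \<Sum>i\<le>k. real (k choose i) * split_at e ((add_car l e p ^^ i) f) ((add_car e r p ^^ (k - i)) g) U)"
proof (induction k)
  case 0
  then show ?case by simp
next
  case (Suc k)
  let ?s = "\<lambda>i j. split_at e ((add_car l e p ^^ i) f) ((add_car e r p ^^ j) g)"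
  have "(add_car l r p ^^ Suc k) (split_at e f g) = add_car l r p (\<lambda>U. \<Sum>i\<le>k. real (k choose i) * ?s i (k - i) U)"
    using Suc by simp
  also have "\<dots> = (\<lambda>U. \<Sum>i\<le>k. real (k choose i) * add_car l r p (?s i (k - i)) U)"
    using add_car_pow_sum[of "{..k}" 1 l r p "\<lambda>i U. real (k choose i) * ?s i (k - i) U"]
    by (simp add: add_car_scale)
  also have "\<dots> = (\<lambda>U. \<Sum>i\<le>k. real (k choose i) * (?s i (Suc k - i) U + ?s (Suc i) (Suc k - Suc i) U))"
    using assms by (intro ext sum.cong refl) (simp add: add_car_split_at Suc_diff_le add_ac)
  also have "\<dots> = (\<lambda>U. \<Sum>i\<le>Suc k. real (Suc k choose i) * ?s i (Suc k - i) U)"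
    by (simp only: binomial_sum_Suc)
  finally show ?case .
qed

section \<open>Blocks at an end of the street\<close>

text \<open>
  The weight of the outcomes in which \<open>k\<close> cars park on \<open>n\<close> spots and fill at least the \<open>i\<close> spots at one
  given end.
\<close>

definition block_tail :: "nat \<Rightarrow> nat \<Rightarrow> nat \<Rightarrow> real" where
  "block_tail k n i = (\<Sum>s=i..<n. block_weight k n s)"

lemma sum_mult_block_tail:
  "(\<Sum>i=1..n. h i * block_tail k n i) = (\<Sum>s<n. (\<Sum>i=1..s. h i) * block_weight k n s)"
proof -
  have "(\<Sum>i=1..n. h i * block_tail k n i) =
      (\<Sum>i\<in>{1..n}. \<Sum>s\<in>{s \<in> {..<n}. i \<le> s}. h i * block_weight k n s)"
    unfolding block_tail_def sum_distrib_left by (intro sum.cong) auto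
  also have "\<dots> = (\<Sum>s\<in>{..<n}. \<Sum>i\<in>{i \<in> {1..n}. i \<le> s}. h i * block_weight k n s)"
    by (rule sum.swap_restrict) auto
  also have "\<dots> = (\<Sum>s<n. (\<Sum>i=1..s. h i) * block_weight k n s)"
    unfolding sum_distrib_right by (intro sum.cong) auto
  finally show ?thesis .
qed

lemma sum_block_tail: "(\<Sum>i=1..n. block_tail k n i) = (\<Sum>s<n. real s * block_weight k n s)"
  using sum_mult_block_tail[of "\<lambda>_. 1"] by simp

lemma block_tail_nonneg: "k < n \<Longrightarrow> 0 \<le> block_tail k n i"
  unfolding block_tail_def by (intro sum_nonneg block_weight_nonneg)

text \<open>
  A car fails forward exactly if its spot and all later ones are taken, and backward exactly if its spot
  and all earlier ones are.
\<close>

lemma try_pref_one: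
  assumes "l < a" "a < r"
  shows "try_pref l r p a (\<lambda>_. 1) U =
    1 - p * of_bool ({a..<r} \<subseteq> U) - (1 - p) * of_bool ({l<..a} \<subseteq> U)"
proof (cases "a \<in> U")
  case True
  have "{s \<in> {l<..<r}. a < s \<and> s \<notin> U} = {} \<longleftrightarrow> {a..<r} \<subseteq> U"
  proof -
    have "{a..<r} = insert a {a<..<r}" "{s \<in> {l<..<r}. a < s \<and> s \<notin> U} = {a<..<r} - U"
      using assms by auto
    then show ?thesis using True by auto
  qed
  moreover have "{s \<in> {l<..<r}. s < a \<and> s \<notin> U} = {} \<longleftrightarrow> {l<..a} \<subseteq> U"
  proof -
    have "{l<..a} = insert a {l<..<a}" "{s \<in> {l<..<r}. s < a \<and> s \<notin> U} = {l<..<a} - U"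
      using assms by auto
    then show ?thesis using True by auto
  qed
  ultimately show ?thesis
    using True unfolding try_pref_def Let_def by (simp add: algebra_simps)
next
  case False
  then have "\<not> {a..<r} \<subseteq> U" "\<not> {l<..a} \<subseteq> U" using assms by auto
  then show ?thesis using False by (simp add: try_pref_def)
qed

lemma add_car_pow_full:
  "(add_car l r p ^^ i) (\<lambda>X. of_bool ({l<..<r} \<subseteq> X)) {} =
   (if i = r - l - 1 then (add_car l r p ^^ i) (\<lambda>_. 1) {} else 0)"
proof -
  have "(add_car l r p ^^ i) (\<lambda>X. of_bool ({l<..<r} \<subseteq> X)) {} =
        (add_car l r p ^^ i) (\<lambda>X. of_bool (i = r - l - 1) * 1) {}"
  proof (rule add_car_pow_cong)
    fix X assume X: "finite X" "X \<subseteq> {} \<union> {l<..<r}" "card X = card {} + i"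
    have "{l<..<r} \<subseteq> X \<longleftrightarrow> i = r - l - 1"
    proof
      assume "{l<..<r} \<subseteq> X"
      with X have "X = {l<..<r}" by blast
      then show "i = r - l - 1" using X by simp
    next
      assume "i = r - l - 1"
      then have "X = {l<..<r}" using X by (intro card_subset_eq) auto
      then show "{l<..<r} \<subseteq> X" by simp
    qed
    then show "of_bool ({l<..<r} \<subseteq> X) = of_bool (i = r - l - 1) * (1::real)" by simp
  qed simp
  also have "\<dots> = of_bool (i = r - l - 1) * (add_car l r p ^^ i) (\<lambda>_. 1) {}"
    by (simp only: add_car_pow_scale)
  finally show ?thesis by simp
qed

text \<open>
  Since there are fewer cars than spots, there is a last empty spot \<open>e\<close>, and the spots from \<open>a\<close> on are
  occupied exactly if \<open>e < a\<close>. For each \<open>e\<close> the two sides are independent, and the right side must be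
  filled by exactly \<open>r - e - 1\<close> cars. The weights of the two sides enter as a hypothesis because the
  induction in \<open>add_car_pow_one\<close> supplies them for at most \<open>k\<close> cars.
\<close>

lemma add_car_pow_suffix:
  assumes weight: "\<And>j l r. \<lbrakk>j \<le> k; l < r; j \<le> r - l - 1\<rbrakk> \<Longrightarrow> (add_car l r p ^^ j) (\<lambda>_. 1) {} = park_weight j (r - l - 1)"
    and k: "k < r - l - 1" and a: "l < a" "a \<le> r"
  shows "(add_car l r p ^^ k) (\<lambda>X. of_bool ({a..<r} \<subseteq> X)) {} = block_tail k (r - l - 1) (r - a)"
proof -
  let ?full = "\<lambda>e X. of_bool ({e<..<r} \<subseteq> X) :: real"
  have "(add_car l r p ^^ k) (\<lambda>X. of_bool ({a..<r} \<subseteq> X)) {} =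
        (add_car l r p ^^ k) (\<lambda>X. \<Sum>e\<in>{l<..<a}. split_at e (\<lambda>_. 1) (?full e) X) {}"
  proof (rule add_car_pow_cong)
    fix X assume X: "finite X" "X \<subseteq> {} \<union> {l<..<r}" "card X = card {} + k"
    have split: "split_at e (\<lambda>_. 1) (?full e) X = of_bool (e \<notin> X \<and> {e<..<r} \<subseteq> X)" for e
      by (auto simp: split_at_def)
    show "of_bool ({a..<r} \<subseteq> X) = (\<Sum>e\<in>{l<..<a}. split_at e (\<lambda>_. 1) (?full e) X)"
    proof (cases "{a..<r} \<subseteq> X")
      case True
      \<comment> \<open>The only nonzero summand is that of the last empty spot.\<close>
      let ?E = "{l<..<r} - X"
      define m where "m = Max ?E"
      have "?E \<noteq> {}"
      proof
        assume "?E = {}"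
        then have "card {l<..<r} \<le> card X" using X(1) by (intro card_mono) auto
        then show False using X(3) k by simp
      qed
      then have m: "m \<in> ?E" unfolding m_def by (intro Max_in) auto
      have max: "e \<le> m" if "e \<in> ?E" for e unfolding m_def using that by (intro Max_ge) auto
      have "m < a" using m True by (meson DiffD1 DiffD2 atLeastLessThan_iff greaterThanLessThan_iff not_le subsetD)
      have "e \<notin> X \<and> {e<..<r} \<subseteq> X \<longleftrightarrow> e = m" if e: "e \<in> {l<..<a}" for e
      proof
        assume *: "e \<notin> X \<and> {e<..<r} \<subseteq> X"
        then have "e \<le> m" using e a by (intro max) auto
        moreover have "\<not> e < m" using * m by auto
        ultimately show "e = m" by simp
      next
        assume "e = m"
        moreover have "{m<..<r} \<subseteq> X"
        proof
          fix x assume x: "x \<in> {m<..<r}"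
          show "x \<in> X"
          proof (rule ccontr)
            assume "x \<notin> X"
            then have "x \<le> m" using x m by (intro max) auto
            then show False using x by simp
          qed
        qed
        ultimately show "e \<notin> X \<and> {e<..<r} \<subseteq> X" using m by simp
      qed
      then have "(\<Sum>e\<in>{l<..<a}. split_at e (\<lambda>_. 1) (?full e) X) = (\<Sum>e\<in>{l<..<a}. of_bool (e = m))"
        by (intro sum.cong refl) (simp add: split)
      also have "\<dots> = 1" using m \<open>m < a\<close> by (simp add: of_bool_def)
      finally show ?thesis using True by simp
    next
      case False
      then have "\<not> {e<..<r} \<subseteq> X" if "e \<in> {l<..<a}" for e
      proof -
        have "{a..<r} \<subseteq> {e<..<r}" using that by auto
        then show ?thesis using False by blast
      qed
      then show ?thesis using False by (simp add: split)
    qed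
  qed simp
  also have "\<dots> = (\<Sum>e\<in>{l<..<a}. (add_car l r p ^^ k) (split_at e (\<lambda>_. 1) (?full e)) {})"
    by (subst add_car_pow_sum) auto
  also have "\<dots> = (\<Sum>e\<in>{l<..<a}. block_weight k (r - l - 1) (r - e - 1))"
  proof (rule sum.cong[OF refl])
    fix e assume e: "e \<in> {l<..<a}"
    let ?s = "r - e - 1"
    have "(add_car l r p ^^ k) (split_at e (\<lambda>_. 1) (?full e)) {} =
        (\<Sum>i\<le>k. real (k choose i) * ((add_car l e p ^^ i) (\<lambda>_. 1) {} * (add_car e r p ^^ (k - i)) (?full e) {}))"
      using e a by (subst add_car_pow_split_at) (auto simp: split_at_def)
    also have "\<dots> = (\<Sum>i\<le>k. if k - i = ?s then real (k choose i) * ((add_car l e p ^^ i) (\<lambda>_. 1) {} * (add_car e r p ^^ (k - i)) (\<lambda>_. 1) {}) else 0)"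
      by (intro sum.cong refl) (simp add: add_car_pow_full)
    also have "\<dots> = block_weight k (r - l - 1) ?s"
    proof (cases "?s \<le> k")
      case True
      then have "k - i = ?s \<longleftrightarrow> i = k - ?s" if "i \<in> {..k}" for i using that by auto
      then have "(\<Sum>i\<le>k. if k - i = ?s then real (k choose i) * ((add_car l e p ^^ i) (\<lambda>_. 1) {} * (add_car e r p ^^ (k - i)) (\<lambda>_. 1) {}) else 0) =
        (\<Sum>i\<le>k. if i = k - ?s then real (k choose i) * ((add_car l e p ^^ i) (\<lambda>_. 1) {} * (add_car e r p ^^ (k - i)) (\<lambda>_. 1) {}) else 0)"
        by (intro sum.cong refl) simp
      also have "\<dots> = real (k choose (k - ?s)) * ((add_car l e p ^^ (k - ?s)) (\<lambda>_. 1) {} * (add_car e r p ^^ (k - (k - ?s))) (\<lambda>_. 1) {})"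
        by simp
      also have "k - (k - ?s) = ?s" using True by simp
      also have "(add_car e r p ^^ ?s) (\<lambda>_. 1) {} = park_weight ?s ?s"
        using e a True by (intro weight) auto
      also have "(add_car l e p ^^ (k - ?s)) (\<lambda>_. 1) {} = park_weight (k - ?s) (e - l - 1)"
        using e a k True by (intro weight) auto
      also have "e - l - 1 = r - l - 1 - Suc ?s"
        using e a by auto
      finally show ?thesis
        using True by (simp add: block_weight_def binomial_symmetric[symmetric])
    next
      case False
      then have "k - i \<noteq> ?s" for i by linarith
      then show ?thesis using False by (simp add: block_weight_def binomial_eq_0)
    qed
    finally show "(add_car l r p ^^ k) (split_at e (\<lambda>_. 1) (?full e)) {} = block_weight k (r - l - 1) ?s" .
  qed
  also have "\<dots> = block_tail k (r - l - 1) (r - a)"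
    unfolding block_tail_def
    by (rule sum.reindex_bij_witness[of _ "\<lambda>s. r - s - 1" "\<lambda>e. r - e - 1"]) (use a k in auto)
  finally show ?thesis .
qed

text \<open>
  The mirror image, with the first empty spot in place of the last one. The decomposition yields the
  same weights, although the coin is biased.
\<close>

lemma add_car_pow_prefix:
  assumes weight: "\<And>j l r. \<lbrakk>j \<le> k; l < r; j \<le> r - l - 1\<rbrakk> \<Longrightarrow> (add_car l r p ^^ j) (\<lambda>_. 1) {} = park_weight j (r - l - 1)"
    and k: "k < r - l - 1" and a: "l \<le> a" "a < r"
  shows "(add_car l r p ^^ k) (\<lambda>X. of_bool ({l<..a} \<subseteq> X)) {} = block_tail k (r - l - 1) (a - l)"
proof -
  let ?full = "\<lambda>e X. of_bool ({l<..<e} \<subseteq> X) :: real"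
  have "(add_car l r p ^^ k) (\<lambda>X. of_bool ({l<..a} \<subseteq> X)) {} =
        (add_car l r p ^^ k) (\<lambda>X. \<Sum>e\<in>{a<..<r}. split_at e (?full e) (\<lambda>_. 1) X) {}"
  proof (rule add_car_pow_cong)
    fix X assume X: "finite X" "X \<subseteq> {} \<union> {l<..<r}" "card X = card {} + k"
    have split: "split_at e (?full e) (\<lambda>_. 1) X = of_bool (e \<notin> X \<and> {l<..<e} \<subseteq> X)" for e
      by (auto simp: split_at_def)
    show "of_bool ({l<..a} \<subseteq> X) = (\<Sum>e\<in>{a<..<r}. split_at e (?full e) (\<lambda>_. 1) X)"
    proof (cases "{l<..a} \<subseteq> X")
      case True
      \<comment> \<open>The only nonzero summand is that of the first empty spot.\<close>
      let ?E = "{l<..<r} - X"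
      define m where "m = Min ?E"
      have "?E \<noteq> {}"
      proof
        assume "?E = {}"
        then have "card {l<..<r} \<le> card X" using X(1) by (intro card_mono) auto
        then show False using X(3) k by simp
      qed
      then have m: "m \<in> ?E" unfolding m_def by (intro Min_in) auto
      have min: "m \<le> e" if "e \<in> ?E" for e unfolding m_def using that by (intro Min_le) auto
      have "a < m" using m True by (meson DiffD1 DiffD2 greaterThanAtMost_iff greaterThanLessThan_iff not_le subsetD)
      have "e \<notin> X \<and> {l<..<e} \<subseteq> X \<longleftrightarrow> e = m" if e: "e \<in> {a<..<r}" for e
      proof
        assume *: "e \<notin> X \<and> {l<..<e} \<subseteq> X"
        then have "m \<le> e" using e a by (intro min) auto
        moreover have "\<not> m < e" using * m by auto
        ultimately show "e = m" by simp
      next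
        assume "e = m"
        moreover have "{l<..<m} \<subseteq> X"
        proof
          fix x assume x: "x \<in> {l<..<m}"
          show "x \<in> X"
          proof (rule ccontr)
            assume "x \<notin> X"
            then have "m \<le> x" using x m by (intro min) auto
            then show False using x by simp
          qed
        qed
        ultimately show "e \<notin> X \<and> {l<..<e} \<subseteq> X" using m by simp
      qed
      then have "(\<Sum>e\<in>{a<..<r}. split_at e (?full e) (\<lambda>_. 1) X) = (\<Sum>e\<in>{a<..<r}. of_bool (e = m))"
        by (intro sum.cong refl) (simp add: split)
      also have "\<dots> = 1" using m \<open>a < m\<close> by (simp add: of_bool_def)
      finally show ?thesis using True by simp
    next
      case False
      then have "\<not> {l<..<e} \<subseteq> X" if "e \<in> {a<..<r}" for e
        using that by fastforce
      then show ?thesis using False by (simp add: split)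
    qed
  qed simp
  also have "\<dots> = (\<Sum>e\<in>{a<..<r}. (add_car l r p ^^ k) (split_at e (?full e) (\<lambda>_. 1)) {})"
    by (subst add_car_pow_sum) auto
  also have "\<dots> = (\<Sum>e\<in>{a<..<r}. block_weight k (r - l - 1) (e - l - 1))"
  proof (rule sum.cong[OF refl])
    fix e assume e: "e \<in> {a<..<r}"
    let ?s = "e - l - 1"
    have "(add_car l r p ^^ k) (split_at e (?full e) (\<lambda>_. 1)) {} =
        (\<Sum>i\<le>k. real (k choose i) * ((add_car l e p ^^ i) (?full e) {} * (add_car e r p ^^ (k - i)) (\<lambda>_. 1) {}))"
      using e a by (subst add_car_pow_split_at) (auto simp: split_at_def)
    also have "\<dots> = (\<Sum>i\<le>k. if i = ?s then real (k choose i) * ((add_car l e p ^^ i) (\<lambda>_. 1) {} * (add_car e r p ^^ (k - i)) (\<lambda>_. 1) {}) else 0)"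
      by (intro sum.cong refl) (simp add: add_car_pow_full)
    also have "\<dots> = block_weight k (r - l - 1) ?s"
    proof (cases "?s \<le> k")
      case True
      then have "(\<Sum>i\<le>k. if i = ?s then real (k choose i) * ((add_car l e p ^^ i) (\<lambda>_. 1) {} * (add_car e r p ^^ (k - i)) (\<lambda>_. 1) {}) else 0) =
        real (k choose ?s) * ((add_car l e p ^^ ?s) (\<lambda>_. 1) {} * (add_car e r p ^^ (k - ?s)) (\<lambda>_. 1) {})"
        by (subst sum.delta) auto
      also have "(add_car l e p ^^ ?s) (\<lambda>_. 1) {} = park_weight ?s ?s"
        using e a True by (intro weight) auto
      also have "(add_car e r p ^^ (k - ?s)) (\<lambda>_. 1) {} = park_weight (k - ?s) (r - e - 1)"
        using e a k True by (intro weight) auto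
      also have "r - e - 1 = r - l - 1 - Suc ?s"
        using e a by auto
      finally show ?thesis by (simp add: block_weight_def)
    next
      case False
      then show ?thesis by (simp add: block_weight_def binomial_eq_0)
    qed
    finally show "(add_car l r p ^^ k) (split_at e (?full e) (\<lambda>_. 1)) {} = block_weight k (r - l - 1) ?s" .
  qed
  also have "\<dots> = block_tail k (r - l - 1) (a - l)"
    unfolding block_tail_def
    by (rule sum.reindex_bij_witness[of _ "\<lambda>s. l + s + 1" "\<lambda>e. e - l - 1"]) (use a k in auto)
  finally show ?thesis .
qed

lemma add_car_pow_try_pref:
  assumes weight: "\<And>j l r. \<lbrakk>j \<le> k; l < r; j \<le> r - l - 1\<rbrakk> \<Longrightarrow> (add_car l r p ^^ j) (\<lambda>_. 1) {} = park_weight j (r - l - 1)"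
    and k: "k < r - l - 1" and a: "l < a" "a < r"
  shows "(add_car l r p ^^ k) (try_pref l r p a (\<lambda>_. 1)) {} =
    park_weight k (r - l - 1) - p * block_tail k (r - l - 1) (r - a) - (1 - p) * block_tail k (r - l - 1) (a - l)"
proof -
  let ?A = "add_car l r p ^^ k"
  have "try_pref l r p a (\<lambda>_. 1) = (\<lambda>U. (1 + (- p) * of_bool ({a..<r} \<subseteq> U)) + (-(1 - p)) * of_bool ({l<..a} \<subseteq> U))"
    using a by (simp add: try_pref_one fun_eq_iff)
  then have "?A (try_pref l r p a (\<lambda>_. 1)) {} =
     ?A (\<lambda>_. 1) {} + (- p) * ?A (\<lambda>U. of_bool ({a..<r} \<subseteq> U)) {} + (-(1 - p)) * ?A (\<lambda>U. of_bool ({l<..a} \<subseteq> U)) {}"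
    by (simp only: add_car_pow_add add_car_pow_scale)
  also have "?A (\<lambda>_. 1) {} = park_weight k (r - l - 1)"
    using a k by (intro weight) auto
  also have "?A (\<lambda>U. of_bool ({a..<r} \<subseteq> U)) {} = block_tail k (r - l - 1) (r - a)"
    using a by (intro add_car_pow_suffix weight k) auto
  also have "?A (\<lambda>U. of_bool ({l<..a} \<subseteq> U)) {} = block_tail k (r - l - 1) (a - l)"
    using a by (intro add_car_pow_prefix weight k) auto
  finally show ?thesis by (simp add: algebra_simps)
qed

text \<open>
  The last of \<open>j + 1\<close> cars has \<open>n\<close> preferences available and fails only because of a full end block. Summed
  over its preference, the forward and the backward failures have the same total, namely the sum of all
  end block lengths. They are weighted with \<open>p\<close> and \<open>1 - p\<close>, so \<open>p\<close> cancels, and the resulting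
  recursion in the number of cars is the one that \<^const>\<open>park_weight\<close> satisfies.
\<close>

theorem add_car_pow_one:
  assumes "l < r" "k \<le> r - l - 1"
  shows "(add_car l r p ^^ k) (\<lambda>_. 1) {} = park_weight k (r - l - 1)"
  using assms
proof (induction k arbitrary: l r rule: less_induct)
  case (less k)
  show ?case
  proof (cases k)
    case 0
    then show ?thesis by (simp add: park_weight_def)
  next
    case (Suc j)
    define n where "n = r - l - 1"
    have j: "j < n" using less.prems Suc by (simp add: n_def)
    have weight: "(add_car l' r' p ^^ i) (\<lambda>_. 1) {} = park_weight i (r' - l' - 1)"
      if "i \<le> j" "l' < r'" "i \<le> r' - l' - 1" for i l' r'
      using that Suc by (intro less.IH) auto
    have "(add_car l r p ^^ k) (\<lambda>_. 1) {} = (add_car l r p ^^ j) (\<lambda>U. \<Sum>a\<in>{l<..<r}. try_pref l r p a (\<lambda>_. 1) U) {}"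
      unfolding Suc funpow_Suc_right o_def add_car_def ..
    also have "\<dots> = (\<Sum>a\<in>{l<..<r}. (add_car l r p ^^ j) (try_pref l r p a (\<lambda>_. 1)) {})"
      by (subst add_car_pow_sum) auto
    also have "\<dots> = (\<Sum>a\<in>{l<..<r}. park_weight j n - p * block_tail j n (r - a) - (1 - p) * block_tail j n (a - l))"
      using j weight unfolding n_def by (intro sum.cong refl add_car_pow_try_pref) auto
    also have "\<dots> = real n * park_weight j n - p * (\<Sum>a\<in>{l<..<r}. block_tail j n (r - a)) - (1 - p) * (\<Sum>a\<in>{l<..<r}. block_tail j n (a - l))"
      by (simp add: sum_subtractf sum_distrib_left n_def)
    also have "(\<Sum>a\<in>{l<..<r}. block_tail j n (r - a)) = (\<Sum>i=1..n. block_tail j n i)"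
      by (rule sum.reindex_bij_witness[of _ "\<lambda>i. r - i" "\<lambda>a. r - a"]) (use less.prems in \<open>auto simp: n_def\<close>)
    also have "(\<Sum>a\<in>{l<..<r}. block_tail j n (a - l)) = (\<Sum>i=1..n. block_tail j n i)"
      by (rule sum.reindex_bij_witness[of _ "\<lambda>i. l + i" "\<lambda>a. a - l"]) (use less.prems in \<open>auto simp: n_def\<close>)
    also have "(\<Sum>i=1..n. block_tail j n i) = real j * (real n + 1) ^ j / (real n + 1)"
      using j by (simp only: sum_block_tail sum_block_weight_length)
    also have "real n * park_weight j n - p * (real j * (real n + 1) ^ j / (real n + 1)) - (1 - p) * (real j * (real n + 1) ^ j / (real n + 1))
        = (real n * (real n + 1 - real j) - real j) * (real n + 1) ^ j / (real n + 1)"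
      by (simp add: park_weight_def algebra_simps diff_divide_distrib add_divide_distrib)
    also have "real n * (real n + 1 - real j) - real j = (real n + 1 - real k) * (real n + 1)"
      by (simp add: Suc algebra_simps)
    finally show ?thesis by (simp add: Suc park_weight_def n_def)
  qed
qed

lemma last_car_weight:
  assumes "k < n" "1 \<le> j" "j \<le> n"
  shows "(add_car 0 (Suc n) p ^^ k) (try_pref 0 (Suc n) p j (\<lambda>_. 1)) {} =
    park_weight k n - p * block_tail k n (Suc n - j) - (1 - p) * block_tail k n j"
  using add_car_pow_try_pref[of k p "Suc n" 0 j] add_car_pow_one assms by auto

text \<open>
  The empty suffix is always occupied.
\<close>

lemma park_weight_eq_block_tail: "k < n \<Longrightarrow> park_weight k n = block_tail k n 0"
  using add_car_pow_suffix[of k 0 "Suc n" 0 "Suc n"] add_car_pow_one[of 0 "Suc n" k 0] add_car_pow_one by auto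

section \<open>From the random process to the operator\<close>

lemma measure_bind_pmf_eq_integral:
  "measure (measure_pmf (bind_pmf M N)) X = (\<integral>x. measure (measure_pmf (N x)) X \<partial>measure_pmf M)"
proof -
  have "ennreal (measure (measure_pmf (bind_pmf M N)) X) = (\<integral>\<^sup>+x. ennreal (measure (measure_pmf (N x)) X) \<partial>measure_pmf M)"
    by (simp flip: measure_pmf.emeasure_eq_measure)
  also have "\<dots> = ennreal (\<integral>x. measure (measure_pmf (N x)) X \<partial>measure_pmf M)"
    by (intro nn_integral_eq_integral measure_pmf.integrable_const_bound[of _ 1]) auto
  finally show ?thesis by (simp add: integral_nonneg_AE)
qed

lemma prob_park_cars:
  assumes "0 \<le> p" "p \<le> 1"
  shows "measure_pmf.prob (park_cars n p U \<alpha>) {rs. None \<notin> set rs} =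
    foldr (try_pref 0 (Suc n) p) \<alpha> (\<lambda>_. 1) U"
proof (induction \<alpha> arbitrary: U)
  case Nil
  then show ?case by simp
next
  case (Cons a \<alpha>)
  let ?g = "foldr (try_pref 0 (Suc n) p) \<alpha> (\<lambda>_. 1)"
  let ?next = "\<lambda>r. map_pmf ((#) r) (park_cars n p (U \<union> set_option r) \<alpha>)"
  have next_prob: "measure_pmf.prob (?next r) {rs. None \<notin> set rs} =
      (case r of None \<Rightarrow> 0 | Some s \<Rightarrow> ?g (insert s U))" for r
    using Cons.IH[of "insert (the r) U"] by (cases r) (simp_all add: vimage_def)
  have bind: "park_cars n p U (a # \<alpha>) = bind_pmf (park_car n p U a) ?next"
    by (simp add: map_pmf_def)
  have street: "{1..n} = {0<..<Suc n}" by auto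
  show ?case
  proof (cases "a \<in> U")
    case False
    then have "park_cars n p U (a # \<alpha>) = ?next (Some a)"
      unfolding bind by (simp add: park_car_def bind_return_pmf)
    then have "measure_pmf.prob (park_cars n p U (a # \<alpha>)) {rs. None \<notin> set rs} = ?g (insert a U)"
      by (simp only: next_prob option.case)
    then show ?thesis
      using False try_pref_def[of 0 "Suc n" p a ?g U] by simp
  next
    case True
    then have "park_cars n p U (a # \<alpha>) = bind_pmf (bernoulli_pmf p)
        (\<lambda>b. ?next (if b then forward_spot n U a else backward_spot n U a))"
      unfolding bind by (simp add: park_car_def bind_assoc_pmf bind_return_pmf)
    then have "measure_pmf.prob (park_cars n p U (a # \<alpha>)) {rs. None \<notin> set rs} =
       p * (case forward_spot n U a of None \<Rightarrow> 0 | Some s \<Rightarrow> ?g (insert s U)) +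
       (1 - p) * (case backward_spot n U a of None \<Rightarrow> 0 | Some s \<Rightarrow> ?g (insert s U))"
      using assms by (simp only: measure_bind_pmf_eq_integral next_prob) (simp add: mult.commute)
    moreover have "(case forward_spot n U a of None \<Rightarrow> 0 | Some s \<Rightarrow> ?g (insert s U)) =
        (let F = {s \<in> {0<..<Suc n}. a < s \<and> s \<notin> U} in if F = {} then 0 else ?g (insert (Min F) U))"
      unfolding forward_spot_def street Let_def
      by (cases "{s \<in> {0<..<Suc n}. a < s \<and> s \<notin> U} = {}") (simp_all only: simp_thms if_True if_False option.case)
    moreover have "(case backward_spot n U a of None \<Rightarrow> 0 | Some s \<Rightarrow> ?g (insert s U)) =
        (let B = {s \<in> {0<..<Suc n}. s < a \<and> s \<notin> U} in if B = {} then 0 else ?g (insert (Max B) U))"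
      unfolding backward_spot_def street Let_def
      by (cases "{s \<in> {0<..<Suc n}. s < a \<and> s \<notin> U} = {}") (simp_all only: simp_thms if_True if_False option.case)
    ultimately show ?thesis
      using True by (simp only: foldr.simps o_apply try_pref_def[of 0 "Suc n" p a ?g U] not_True_eq_False if_False)
  qed
qed

lemma finite_pref_lists: "finite (pref_lists m n)"
  unfolding pref_lists_def using finite_lists_length_eq[of "{1..n}" m] by (simp add: conj_commute)

text \<open>
  The last preference is split off, rather than the first one, because it is the one that the
  conditional law concerns.
\<close>

lemma sum_pref_lists_Suc:
  "(\<Sum>\<alpha>\<in>pref_lists (Suc k) n. F \<alpha>) = (\<Sum>a=1..n. \<Sum>\<beta>\<in>pref_lists k n. F (\<beta> @ [a]))"
proof -
  have "(\<Sum>a=1..n. \<Sum>\<beta>\<in>pref_lists k n. F (\<beta> @ [a])) = (\<Sum>(a, \<beta>)\<in>{1..n} \<times> pref_lists k n. F (\<beta> @ [a]))"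
    by (rule sum.cartesian_product)
  also have "\<dots> = (\<Sum>\<alpha>\<in>pref_lists (Suc k) n. F \<alpha>)"
  proof (rule sum.reindex_bij_witness[of _ "\<lambda>\<alpha>. (last \<alpha>, butlast \<alpha>)" "\<lambda>(a, \<beta>). \<beta> @ [a]"], goal_cases)
    case (4 \<alpha>)
    then have "\<alpha> \<noteq> []" by (auto simp: pref_lists_def)
    then have "\<alpha> = butlast \<alpha> @ [last \<alpha>]" by simp
    then have "set \<alpha> = insert (last \<alpha>) (set (butlast \<alpha>))"
      by (metis Un_insert_right list.simps(15) set_append sup_bot.right_neutral list.set(1))
    then show ?case using 4 by (auto simp: pref_lists_def)
  next
    case (3 \<alpha>)
    then have "\<alpha> \<noteq> []" by (auto simp: pref_lists_def)
    then show ?case by simp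
  qed (auto simp: pref_lists_def)
  finally show ?thesis ..
qed

lemma sum_pref_lists_foldr:
  "(\<Sum>\<alpha>\<in>pref_lists k n. foldr (try_pref 0 (Suc n) p) \<alpha> g U) = (add_car 0 (Suc n) p ^^ k) g U"
proof (induction k arbitrary: g)
  case 0
  have "pref_lists 0 n = {[]}" by (auto simp: pref_lists_def)
  then show ?case by simp
next
  case (Suc k)
  have street: "{0<..<Suc n} = {1..n}" by auto
  have "(\<Sum>\<alpha>\<in>pref_lists (Suc k) n. foldr (try_pref 0 (Suc n) p) \<alpha> g U) =
      (\<Sum>a=1..n. (add_car 0 (Suc n) p ^^ k) (try_pref 0 (Suc n) p a g) U)"
    by (simp add: sum_pref_lists_Suc Suc)
  also have "\<dots> = (add_car 0 (Suc n) p ^^ k) (add_car 0 (Suc n) p g) U"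
    unfolding add_car_def[of _ _ _ g, abs_def] street by (subst add_car_pow_sum) auto
  finally show ?case by (simp add: funpow_swap1)
qed

lemma prob_parking_pmf:
  assumes "0 \<le> p" "p \<le> 1" "0 < n"
  shows "measure_pmf.prob (parking_pmf m n p) {\<omega>. C (fst \<omega>) \<and> all_parked \<omega>} =
    (\<Sum>\<alpha>\<in>pref_lists m n. of_bool (C \<alpha>) * foldr (try_pref 0 (Suc n) p) \<alpha> (\<lambda>_. 1) {}) / card (pref_lists m n)"
proof -
  have "replicate m 1 \<in> pref_lists m n" using assms by (auto simp: pref_lists_def)
  then have ne: "pref_lists m n \<noteq> {}" by auto
  have "parking_pmf m n p = bind_pmf (pmf_of_set (pref_lists m n)) (\<lambda>\<alpha>. map_pmf (Pair \<alpha>) (park_cars n p {} \<alpha>))"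
    by (simp add: parking_pmf_def map_pmf_def)
  then have "measure_pmf.prob (parking_pmf m n p) {\<omega>. C (fst \<omega>) \<and> all_parked \<omega>} =
     (\<Sum>\<alpha>\<in>pref_lists m n. measure_pmf.prob (park_cars n p {} \<alpha>) {rs. C \<alpha> \<and> None \<notin> set rs}) / card (pref_lists m n)"
    using ne finite_pref_lists
    by (simp add: measure_bind_pmf_eq_integral integral_pmf_of_set vimage_def all_parked_def)
  moreover have "measure_pmf.prob (park_cars n p {} \<alpha>) {rs. C \<alpha> \<and> None \<notin> set rs} =
      of_bool (C \<alpha>) * foldr (try_pref 0 (Suc n) p) \<alpha> (\<lambda>_. 1) {}" for \<alpha>
    using prob_park_cars[OF assms(1,2), of n "{}" \<alpha>] by (cases "C \<alpha>") auto
  ultimately show ?thesis by simp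
qed

text \<open>
  The event \<open>a\<^sub>m = j\<close> fixes the last factor of the product of one-car operators, while the preferences
  of the first \<open>m - 1\<close> cars are summed freely and give a power of \<^const>\<open>add_car\<close>.
\<close>

theorem Q_eq:
  assumes "1 \<le> m" "m \<le> n" "0 \<le> p" "p \<le> 1" "1 \<le> j" "j \<le> n"
  shows "Q m n p j =
    (park_weight (m - 1) n - p * block_tail (m - 1) n (Suc n - j) - (1 - p) * block_tail (m - 1) n j) / park_weight m n"
proof -
  obtain k where k: "m = Suc k" using assms by (cases m) auto
  let ?T = "try_pref 0 (Suc n) p"
  have "(\<Sum>\<alpha>\<in>pref_lists m n. of_bool (\<alpha> ! (m - 1) = j) * foldr ?T \<alpha> (\<lambda>_. 1) {}) =
      (\<Sum>a=1..n. \<Sum>\<beta>\<in>pref_lists k n. if a = j then foldr ?T \<beta> (?T a (\<lambda>_. 1)) {} else 0)"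
    unfolding k sum_pref_lists_Suc by (intro sum.cong refl) (auto simp: pref_lists_def nth_append)
  also have "\<dots> = (\<Sum>a=1..n. if a = j then \<Sum>\<beta>\<in>pref_lists k n. foldr ?T \<beta> (?T a (\<lambda>_. 1)) {} else 0)"
    by (intro sum.cong) auto
  also have "\<dots> = (\<Sum>\<beta>\<in>pref_lists k n. foldr ?T \<beta> (?T j (\<lambda>_. 1)) {})"
    using assms by simp
  also have "\<dots> = park_weight (m - 1) n - p * block_tail (m - 1) n (Suc n - j) - (1 - p) * block_tail (m - 1) n j"
    using assms k by (simp add: sum_pref_lists_foldr last_car_weight)
  finally have num: "(\<Sum>\<alpha>\<in>pref_lists m n. of_bool (\<alpha> ! (m - 1) = j) * foldr ?T \<alpha> (\<lambda>_. 1) {}) =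
     park_weight (m - 1) n - p * block_tail (m - 1) n (Suc n - j) - (1 - p) * block_tail (m - 1) n j" .
  have den: "(\<Sum>\<alpha>\<in>pref_lists m n. of_bool True * foldr ?T \<alpha> (\<lambda>_. 1) {}) = park_weight m n"
    using add_car_pow_one[of 0 "Suc n" m p] assms by (simp add: sum_pref_lists_foldr)
  have "card (pref_lists m n) \<noteq> 0"
  proof -
    have "replicate m 1 \<in> pref_lists m n" using assms by (auto simp: pref_lists_def)
    then show ?thesis using finite_pref_lists[of m n] by auto
  qed
  then show ?thesis
    unfolding Q_def cond_prob_def
    using prob_parking_pmf[of p n m "\<lambda>\<alpha>. \<alpha> ! (m - 1) = j"] prob_parking_pmf[of p n m "\<lambda>_. True"]
      num den assms by simp
qed

section \<open>Bounds on the total variation distance\<close>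

lemma tv_dist_ge_test_function:
  assumes "\<And>j. 1 \<le> j \<Longrightarrow> j \<le> n \<Longrightarrow> \<bar>f j\<bar> \<le> c"
  shows "\<bar>\<Sum>j=1..n. f j * (P j - R j)\<bar> \<le> 2 * c * tv_dist n P R"
proof -
  have "\<bar>\<Sum>j=1..n. f j * (P j - R j)\<bar> \<le> (\<Sum>j=1..n. \<bar>f j * (P j - R j)\<bar>)"
    by (rule sum_abs)
  also have "\<dots> \<le> (\<Sum>j=1..n. c * \<bar>P j - R j\<bar>)"
    using assms by (intro sum_mono) (auto simp: abs_mult intro!: mult_right_mono)
  finally show ?thesis by (simp add: tv_dist_def sum_distrib_left)
qed

lemma prob_poisson_atMost:
  assumes "0 < r"
  shows "measure_pmf.prob (poisson_pmf r) {z. z \<le> k} = exp (- r) * (\<Sum>z\<le>k. r ^ z / fact z)"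
proof -
  have "{z. z \<le> k} = {..k}" by auto
  then show ?thesis
    using assms by (simp add: measure_measure_pmf_finite sum_distrib_left mult.commute)
qed

lemma park_weight_Suc: "k < n \<Longrightarrow> park_weight (Suc k) n = (real n - real k) * (real n + 1) ^ k"
  by (simp add: park_weight_def)

text \<open>
  The weight of the outcomes in which the first \<open>k\<close> cars park and one more car with preference \<open>j\<close> fails.
\<close>

definition fail_weight :: "nat \<Rightarrow> nat \<Rightarrow> real \<Rightarrow> nat \<Rightarrow> real" where
  "fail_weight k n p j = p * block_tail k n (Suc n - j) + (1 - p) * block_tail k n j"

lemma sum_reflect: "(\<Sum>j=1..n. f (Suc n - j)) = (\<Sum>j=1..n. f j)" for f :: "nat \<Rightarrow> real"
  by (rule sum.reindex_bij_witness[of _ "\<lambda>j. Suc n - j" "\<lambda>j. Suc n - j"]) auto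

lemma sum_fail_weight:
  assumes "k < n"
  shows "(\<Sum>j=1..n. fail_weight k n p j) = real k * (real n + 1) ^ k / (real n + 1)"
proof -
  have "(\<Sum>j=1..n. fail_weight k n p j) = p * (\<Sum>j=1..n. block_tail k n (Suc n - j)) + (1 - p) * (\<Sum>j=1..n. block_tail k n j)"
    by (simp only: fail_weight_def sum.distrib sum_distrib_left)
  also have "\<dots> = (\<Sum>j=1..n. block_tail k n j)"
    unfolding sum_reflect by (simp add: algebra_simps)
  also have "\<dots> = real k * (real n + 1) ^ k / (real n + 1)"
    using assms by (simp only: sum_block_tail sum_block_weight_length)
  finally show ?thesis .
qed

lemma sum_centred_positions:
  "(\<Sum>i=1..s. real i - (real n + 1) / 2) = - (real s * (real n - real s)) / 2"
  by (induction s) (auto simp: field_simps)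

text \<open>
  The test function is odd under the reflection \<open>j \<mapsto> n + 1 - j\<close>, which exchanges the two block
  tails in \<^const>\<open>fail_weight\<close>. Hence these combine with the factor \<open>2 p - 1\<close>, and summation by
  parts leads to the quadratic block sum.
\<close>

lemma sum_centred_fail_weight:
  assumes "k < n"
  shows "(\<Sum>j=1..n. (real j - (real n + 1) / 2) * fail_weight k n p j) =
    (2 * p - 1) / 2 * ((real n - real k) * (exp_trunc k (real n + 1) - (real n + 1) ^ k))"
proof -
  let ?h = "\<lambda>j. real j - (real n + 1) / 2"
  have "(\<Sum>j=1..n. ?h j * fail_weight k n p j) =
      p * (\<Sum>j=1..n. ?h j * block_tail k n (Suc n - j)) + (1 - p) * (\<Sum>j=1..n. ?h j * block_tail k n j)"
    unfolding fail_weight_def sum_distrib_left sum.distrib[symmetric]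
    by (simp only: distrib_left mult.left_commute)
  also have "(\<Sum>j=1..n. ?h j * block_tail k n (Suc n - j)) = (\<Sum>j=1..n. (\<lambda>i. - ?h i * block_tail k n i) (Suc n - j))"
    by (intro sum.cong refl) (auto simp: of_nat_diff field_simps)
  also have "\<dots> = - (\<Sum>j=1..n. ?h j * block_tail k n j)"
    using sum_reflect[of "\<lambda>i. - ?h i * block_tail k n i" n] by (simp only: mult_minus_left sum_negf)
  also have "p * - (\<Sum>j=1..n. ?h j * block_tail k n j) + (1 - p) * (\<Sum>j=1..n. ?h j * block_tail k n j)
      = (2 * p - 1) / 2 * (-2 * (\<Sum>j=1..n. ?h j * block_tail k n j))"
  proof -
    have "p * - x + (1 - p) * x = (2 * p - 1) / 2 * (-2 * x)" for x
      by (simp add: field_simps)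
    then show ?thesis .
  qed
  also have "-2 * (\<Sum>j=1..n. ?h j * block_tail k n j) = (\<Sum>s<n. real s * (real n - real s) * block_weight k n s)"
    unfolding sum_mult_block_tail sum_centred_positions sum_distrib_left
    by (intro sum.cong refl) simp
  also have "\<dots> = (real n - real k) * (exp_trunc k (real n + 1) - (real n + 1) ^ k)"
    by (rule sum_block_weight_quadratic[OF assms])
  finally show ?thesis .
qed

text \<open>
  The deviation of \<^const>\<open>Q\<close> from uniform is that of \<^const>\<open>fail_weight\<close> from its mean, up to sign and
  normalisation, since both laws have total mass \<open>1\<close>.
\<close>

lemma Q_minus_Uni:
  assumes "k < n" "0 \<le> p" "p \<le> 1" "1 \<le> j" "j \<le> n"
  shows "Q (Suc k) n p j - Uni n j =
    ((\<Sum>i=1..n. fail_weight k n p i) / n - fail_weight k n p j) / park_weight (Suc k) n"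
proof -
  have W: "park_weight (Suc k) n > 0" using assms by (simp add: park_weight_Suc)
  have "real n * park_weight k n - (\<Sum>i=1..n. fail_weight k n p i) = park_weight (Suc k) n"
    unfolding sum_fail_weight[OF assms(1)] park_weight_Suc[OF assms(1)] park_weight_def
    by (simp add: divide_simps) (simp add: algebra_simps)
  then have "park_weight k n = park_weight (Suc k) n / n + (\<Sum>i=1..n. fail_weight k n p i) / n"
    using assms by (simp add: field_simps)
  moreover have "Uni n j = 1 / n"
    using assms by (simp add: Uni_def)
  moreover have "Q (Suc k) n p j = (park_weight k n - fail_weight k n p j) / park_weight (Suc k) n"
    using assms by (simp add: Q_eq fail_weight_def algebra_simps)
  ultimately show ?thesis using W by (simp only:) (simp add: diff_divide_distrib add_divide_distrib)
qed

text \<open>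
  For nonnegative numbers the absolute deviations from the mean add up to at most twice the total.
\<close>

lemma tv_dist_upper_bound:
  assumes "k < n" "0 \<le> p" "p \<le> 1"
  shows "tv_dist n (Q (Suc k) n p) (Uni n) \<le> real k / ((real n + 1) * (real n - real k))"
proof -
  define S where "S = (\<Sum>i=1..n. fail_weight k n p i)"
  define W where "W = park_weight (Suc k) n"
  have W: "W > 0" using assms by (simp add: W_def park_weight_Suc)
  have nonneg: "0 \<le> fail_weight k n p j" for j
    using assms by (simp add: fail_weight_def block_tail_nonneg)
  then have S: "0 \<le> S" unfolding S_def by (intro sum_nonneg)
  have "\<bar>Q (Suc k) n p j - Uni n j\<bar> \<le> (S / n + fail_weight k n p j) / W" if "j \<in> {1..n}" for j
  proof -
    have "\<bar>S / n - fail_weight k n p j\<bar> \<le> S / n + fail_weight k n p j"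
      using nonneg[of j] S by (simp add: abs_le_iff)
    moreover have "Q (Suc k) n p j - Uni n j = (S / n - fail_weight k n p j) / W"
      unfolding S_def W_def using that assms by (intro Q_minus_Uni) auto
    ultimately show ?thesis
      using W by (simp add: abs_divide divide_right_mono)
  qed
  then have "tv_dist n (Q (Suc k) n p) (Uni n) \<le> 1/2 * (\<Sum>j=1..n. (S / n + fail_weight k n p j) / W)"
    unfolding tv_dist_def by (intro mult_left_mono sum_mono) auto
  also have "\<dots> = S / W"
  proof -
    have "(\<Sum>j=1..n. (S / n + fail_weight k n p j) / W) = (S + S) / W"
      unfolding S_def sum_divide_distrib[symmetric] sum.distrib using assms by simp
    then show ?thesis by simp
  qed
  also have "\<dots> = real k / ((real n + 1) * (real n - real k))"
    unfolding S_def W_def sum_fail_weight[OF assms(1)] park_weight_Suc[OF assms(1)]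
    using assms by simp
  finally show ?thesis .
qed

text \<open>
  The linear test function \<open>j - (n + 1) / 2\<close> is orthogonal to the uniform law and bounded by \<open>n\<close>; this
  bound accounts for the factor \<open>4 n\<close>.
\<close>

lemma tv_dist_lower_bound_biased:
  assumes "k < n" "0 \<le> p" "p \<le> 1"
  shows "\<bar>2 * p - 1\<bar> / (4 * real n) * \<bar>1 - exp_trunc k (real n + 1) / (real n + 1) ^ k\<bar>
    \<le> tv_dist n (Q (Suc k) n p) (Uni n)"
proof -
  define h where "h j = real j - (real n + 1) / 2" for j
  define S where "S = (\<Sum>i=1..n. fail_weight k n p i)"
  define W where "W = park_weight (Suc k) n"
  define D where "D = exp_trunc k (real n + 1)"
  define P where "P = (real n + 1) ^ k"
  have W: "W = (real n - real k) * P" using assms by (simp add: W_def P_def park_weight_Suc)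
  have P: "P > 0" by (simp add: P_def)
  \<comment> \<open>Hence the constant mean in the deviation drops out of the test.\<close>
  have centred: "(\<Sum>j=1..n. h j) = 0"
    unfolding h_def sum_centred_positions by simp
  have "(\<Sum>j=1..n. h j * (Q (Suc k) n p j - Uni n j)) = (\<Sum>j=1..n. (h j * (S / n) - h j * fail_weight k n p j) / W)"
    using assms by (intro sum.cong refl) (simp add: Q_minus_Uni S_def W_def algebra_simps diff_divide_distrib)
  also have "\<dots> = ((\<Sum>j=1..n. h j) * (S / n) - (\<Sum>j=1..n. h j * fail_weight k n p j)) / W"
    by (simp only: sum_divide_distrib sum_subtractf sum_distrib_right diff_divide_distrib)
  also have "\<dots> = - ((2 * p - 1) / 2 * ((real n - real k) * (D - P))) / W"
    unfolding centred unfolding h_def sum_centred_fail_weight[OF assms(1)] by (simp add: D_def P_def)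
  also have "\<dots> = (2 * p - 1) / 2 * (1 - D / P)"
    using assms P by (simp add: W field_simps)
  finally have test: "(\<Sum>j=1..n. h j * (Q (Suc k) n p j - Uni n j)) = (2 * p - 1) / 2 * (1 - D / P)" .
  have "\<bar>h j\<bar> \<le> real n" if "1 \<le> j" "j \<le> n" for j
    using that unfolding h_def abs_le_iff by (auto simp: field_simps)
  from tv_dist_ge_test_function[of n h "real n" "Q (Suc k) n p" "Uni n", OF this]
  have "\<bar>(2 * p - 1) / 2 * (1 - D / P)\<bar> \<le> 2 * real n * tv_dist n (Q (Suc k) n p) (Uni n)"
    unfolding test by simp
  then have "\<bar>2 * p - 1\<bar> * \<bar>1 - D / P\<bar> \<le> 4 * real n * tv_dist n (Q (Suc k) n p) (Uni n)"
    by (simp add: abs_mult)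
  then show ?thesis
    using assms unfolding D_def[symmetric] P_def[symmetric] by (simp add: field_simps)
qed

text \<open>
  If the last spot stays empty, the cars have in effect parked on \<open>n - 1\<close> spots.
\<close>

lemma block_tail_1:
  assumes "k < n"
  shows "block_tail k n 1 = park_weight k n - park_weight k (n - 1)"
proof -
  have "block_tail k n 0 = block_weight k n 0 + block_tail k n 1"
    using assms unfolding block_tail_def by (subst sum.atLeast_Suc_lessThan) auto
  moreover have "block_weight k n 0 = park_weight k (n - 1)"
    by (simp add: block_weight_def park_weight_def)
  ultimately show ?thesis
    using park_weight_eq_block_tail[OF assms] by simp
qed

lemma block_tail_eq_0: "k < i \<Longrightarrow> block_tail k n i = 0"
  unfolding block_tail_def by (intro sum.neutral) (auto simp: block_weight_def binomial_eq_0)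

text \<open>
  For a fair coin the linear test function gives nothing, and the single term \<open>j = 1\<close> is used. There the
  forward failure would need all \<open>n\<close> spots to be taken, so only \<open>block_tail k n 1\<close> matters, which is
  explicit.
\<close>

lemma tv_dist_lower_bound_fair:
  assumes "k < n"
  shows "1/2 * \<bar>real n powi (int (Suc k) - 2) / (2 * (real n + 1) ^ k)
            - 1 / (2 * (real n + 1)) * (1 + (real n - 2 * real (Suc k) + 2) / (real n * (real n - real (Suc k) + 1)))\<bar>
    \<le> tv_dist n (Q (Suc k) n (1/2)) (Uni n)"
proof -
  have n: "real n > 0" "real n - real k > 0" "n \<ge> 1" using assms by auto
  define P where "P = (real n + 1) ^ k"
  have P: "P > 0" by (simp add: P_def)
  have powi: "real n powi (int (Suc k) - 2) = real n ^ k / real n"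
    using n by (simp add: power_int_diff)
  have "Q (Suc k) n (1/2) 1 = (park_weight k n - 1/2 * block_tail k n n - 1/2 * block_tail k n 1) / park_weight (Suc k) n"
    using assms n by (simp add: Q_eq)
  also have "block_tail k n n = 0" using assms by (simp add: block_tail_eq_0)
  also have "park_weight k n - 1/2 * 0 - 1/2 * block_tail k n 1 = 1/2 * park_weight k n + 1/2 * park_weight k (n - 1)"
    unfolding block_tail_1[OF assms] by (simp add: diff_divide_distrib)
  also have "park_weight k n = (real n - real k + 1) * P / (real n + 1)"
    by (simp add: park_weight_def P_def algebra_simps)
  also have "park_weight k (n - 1) = (real n - real k) * (real n ^ k / real n)"
    using n by (simp add: park_weight_def of_nat_diff)
  also have "park_weight (Suc k) n = (real n - real k) * P"
    using assms by (simp add: park_weight_Suc P_def)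
  finally have Q1: "Q (Suc k) n (1/2) 1 =
     (1/2 * ((real n - real k + 1) * P / (real n + 1)) + 1/2 * ((real n - real k) * (real n ^ k / real n))) / ((real n - real k) * P)" .
  have "Uni n 1 = 1 / real n"
    using n by (simp add: Uni_def)
  have "Q (Suc k) n (1/2) 1 - Uni n 1 =
     real n ^ k / real n / (2 * P) + (1/2 * ((real n - real k + 1) / (real n + 1)) / (real n - real k) - 1 / real n)"
  proof -
    have "(1/2 * ((d + 1) * P / x) + 1/2 * (d * q)) / (d * P) - y = q / (2 * P) + (1/2 * ((d + 1) / x) / d - y)"
      if "d > 0" "x > 0" for d q x y :: real
      using that P by (simp add: divide_simps) (simp add: algebra_simps)
    from this[of "real n - real k" "real n + 1" "real n ^ k / real n" "1 / real n"] show ?thesis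
      unfolding Q1 \<open>Uni n 1 = 1 / real n\<close> using n by simp
  qed
  also have "1/2 * ((real n - real k + 1) / (real n + 1)) / (real n - real k) - 1 / real n =
     - (1 / (2 * (real n + 1)) * (1 + (real n - 2 * real (Suc k) + 2) / (real n * (real n - real (Suc k) + 1))))"
  proof -
    have "1/2 * ((d + 1) / (x + 1)) / d - 1 / x = - (1 / (2 * (x + 1)) * (1 + (2 * d - x) / (x * d)))"
      if "d > 0" "x > 0" for d x :: real
    proof -
      have "x + 1 \<noteq> 0" using that by simp
      then show ?thesis using that by (simp add: divide_simps) (simp add: algebra_simps)
    qed
    from this[of "real n - real k" "real n"] show ?thesis using n by simp
  qed
  finally have "\<bar>Q (Suc k) n (1/2) 1 - Uni n 1\<bar> = \<bar>real n powi (int (Suc k) - 2) / (2 * (real n + 1) ^ k)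
            - 1 / (2 * (real n + 1)) * (1 + (real n - 2 * real (Suc k) + 2) / (real n * (real n - real (Suc k) + 1)))\<bar>"
    unfolding powi P_def by simp
  moreover have "\<bar>Q (Suc k) n (1/2) 1 - Uni n 1\<bar> \<le> (\<Sum>j=1..n. \<bar>Q (Suc k) n (1/2) j - Uni n j\<bar>)"
    using n by (intro member_le_sum) auto
  ultimately show ?thesis unfolding tv_dist_def by simp
qed

theorem theorem3p3:
  fixes m n :: nat and p :: real
  assumes "1 \<le> m" and "m \<le> n" and "0 \<le> p" and "p \<le> 1"
  shows "tv_dist n (Q m n p) (Uni n) \<le> (real m - 1) / ((real n + 1) * (real n - real m + 1)) \<and>
         tv_dist n (Q m n p) (Uni n) \<ge>
           \<bar>2 * p - 1\<bar> / (4 * real n) *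
           \<bar>1 - exp (real n + 1) * fact (m - 1)
                  * measure_pmf.prob (poisson_pmf (real n + 1)) {z. z \<le> m - 1}
                / (real n + 1) ^ (m - 1)\<bar> \<and>
         tv_dist n (Q m n (1/2)) (Uni n) \<ge>
           1/2 * \<bar>real n powi (int m - 2) / (2 * (real n + 1) ^ (m - 1))
                  - 1 / (2 * (real n + 1))
                    * (1 + (real n - 2 * real m + 2) / (real n * (real n - real m + 1)))\<bar>"
proof -
  obtain k where k: "m = Suc k" "k < n" using assms by (cases m) auto
  have "exp (real n + 1) * fact k * measure_pmf.prob (poisson_pmf (real n + 1)) {z. z \<le> k} = exp_trunc k (real n + 1)"
  proof -
    have "exp (real n + 1) * (exp (- (real n + 1)) * x) = x" for x
      by (simp only: mult.assoc[symmetric] exp_minus_inverse mult_1_left)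
    then show ?thesis
      by (simp only: prob_poisson_atMost[of "real n + 1"] exp_trunc_def mult.left_commute mult.assoc)
  qed
  then show ?thesis
    using tv_dist_upper_bound[OF k(2) assms(3,4)] tv_dist_lower_bound_biased[OF k(2) assms(3,4)]
      tv_dist_lower_bound_fair[OF k(2)]
    unfolding k(1) by simp
qed

end
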